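(* For all positive integers $n$ and $q$, $$(1)\qquad \sum_{\pi\in S_{n+q-1}} t_1^{inv_q(\pi)}\,t_2^{des_q(\pi^{-1})}=\sum_{\pi\in S_{n+q-1}} t_1^{rmaj_{q,n+q-1}(\pi)}\,t_2^{des_q(\pi^{-1})},$$ and $$(2)\qquad \sum_{\pi\in S_{n+q-1}} t_1^{inv_q(\pi)}\,t_2^{rmaj_{q,n+q-1}(\pi^{-1})}=\sum_{\pi\in S_{n+q-1}} t_1^{rmaj_{q,n+q-1}(\pi)}\,t_2^{rmaj_{q,n+q-1}(\pi^{-1})}.$$
   Context: $t_1,t_2$ are indeterminates. Let $m=n+q-1$ and $\pi\in S_m$. The $q$-inversion number: $inv_q(\pi)=\sum_{i=q+1}^m \min\{\,i-q,\ \#\{j<i\mid \pi(j)>\pi(i)\}\,\}$ (equal to $0$ if $m\le q$). $Del_q(\pi)=\{ i \mid q+1\le i\le m,\ \#\{j<i\mid \pi(j)<\pi(i)\}\le q-1\}$. The $q$-descent set $Des_q(\pi)$ is the set of $i$ with $q\le i\le m-1$ such that $\pi(i)>\pi(i+1)$ or $i+1\in Del_q(\pi)$ (or both); $des_q(\pi)=\#Des_q(\pi)$. The $q$-reverse major index: $rmaj_{q,m}(\pi)=\sum_{i\in Des_q(\pi)}(m-i)$. *)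

theory Defs
  imports "HOL-Combinatorics.Permutations" "HOL-Computational_Algebra.Polynomial"
begin

(* The symmetric group S_m is {p. p permutes {1..m}}, a set of functions on nat fixing
   everything outside {1..m} (in particular 0); hence positions j always range over j \<ge> 1,
   and the group inverse is the function inverse "inv".  All truncating subtractions below
   are exact: i > q resp. i < m wherever they occur, and q \<ge> 1 is assumed in the results. *)

definition inv_q :: "nat \<Rightarrow> nat \<Rightarrow> (nat \<Rightarrow> nat) \<Rightarrow> nat" where
  "inv_q q m p = (\<Sum>i = q+1..m. min (i - q) (card {j. 1 \<le> j \<and> j < i \<and> p j > p i}))"

definition Del_q :: "nat \<Rightarrow> nat \<Rightarrow> (nat \<Rightarrow> nat) \<Rightarrow> nat set" where
  "Del_q q m p =
     {i. q + 1 \<le> i \<and> i \<le> m \<and> card {j. 1 \<le> j \<and> j < i \<and> p j < p i} \<le> q - 1}"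

definition Des_q :: "nat \<Rightarrow> nat \<Rightarrow> (nat \<Rightarrow> nat) \<Rightarrow> nat set" where
  "Des_q q m p = {i. q \<le> i \<and> i < m \<and> (p i > p (i + 1) \<or> i + 1 \<in> Del_q q m p)}"

definition des_q :: "nat \<Rightarrow> nat \<Rightarrow> (nat \<Rightarrow> nat) \<Rightarrow> nat" where
  "des_q q m p = card (Des_q q m p)"

definition rmaj_q :: "nat \<Rightarrow> nat \<Rightarrow> (nat \<Rightarrow> nat) \<Rightarrow> nat" where
  "rmaj_q q m p = (\<Sum>i\<in>Des_q q m p. m - i)"

(* The polynomial ring Z[t1][t2]. *)

definition t1 :: "int poly poly" where
  "t1 = [:[:0, 1:]:]"

definition t2 :: "int poly poly" where
  "t2 = [:0, 1:]"

end

theory Submission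
  imports Defs "HOL-Combinatorics.Multiset_Permutations"
begin

text \<open>
  The idea is to reduce the \<open>q\<close>-statistics on \<open>S\<^sub>m\<close> to the ordinary statistics on \<open>S\<^sub>n\<close>, where
  Foata's transformation applies.  Put \<open>d = q - 1\<close> and let \<open>excess p a b\<close> be the number of
  \<open>j \<le> a\<close> with \<open>p j > b\<close>.  For \<open>p\<close> in \<open>S\<^sub>m\<close> there is a unique \<open>w = collapse d n p\<close> in \<open>S\<^sub>n\<close> with
  \<open>excess w k l = min k (excess p (k + d) (l + d))\<close>.

  This map truncates the Lehmer code: its \<open>k\<close>-th entry for \<open>w\<close> is the minimum of \<open>k - 1\<close> and the
  \<open>(k + d)\<close>-th entry for \<open>p\<close> (\<open>lehmer_collapse\<close>).  Hence \<open>inv_q\<close>, \<open>Des_q\<close> and \<open>rmaj_q\<close> of \<open>p\<close> are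
  the ordinary inversion number, the descent set shifted by \<open>d\<close>, and the ordinary reverse major index of
  \<open>w\<close>.  As the defining relation is symmetric under inversion, the map also commutes with
  inversion (\<open>collapse_inv\<close>), and therefore \<open>w\<close> determines \<open>Des_q\<close> of the inverse of \<open>p\<close> as well.  The
  number of permutations with the same \<open>w\<close> depends only on the number of left-to-right minima
  of \<open>w\<close> (\<open>card_fiber_collapse\<close>).

  It remains to see that on \<open>S\<^sub>n\<close> the inversion number and the reverse major index have the same
  distribution jointly with the inverse descent set and the number of left-to-right minima.
  The mirrored Foata transformation is a bijection that carries the reverse major index to the
  inversion number (\<open>inversions_foata\<close>).  In each of its steps a letter \<open>x\<close> is added, and the
  letters below \<open>x\<close> keep their relative order, as do those above \<open>x\<close>; this preserves the
  inverse descents and the left-to-right minima (\<open>filter_adjacent_foata\<close>, \<open>lr_minima_foata\<close>).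
\<close>

section \<open>A mirrored Foata transformation on words\<close>

text \<open>
  The letter \<open>a\<close> in hand is carried to the right up to the next letter satisfying \<open>P\<close>, dropped
  there, and exchanged for that letter.  Cutting \<open>a # v\<close> before each letter satisfying \<open>P\<close>, this moves
  the first letter of every block to the end of its block.
\<close>

fun slide :: "('a \<Rightarrow> bool) \<Rightarrow> 'a \<Rightarrow> 'a list \<Rightarrow> 'a list" where
  "slide P a [] = [a]"
| "slide P a (b # v) = (if P b then a # slide P b v else b # slide P a v)"

fun foata_turn :: "'a::linorder \<Rightarrow> 'a list \<Rightarrow> 'a list" where
  "foata_turn x [] = []"
| "foata_turn x (a # v) = slide (if a < x then (\<lambda>z. z < x) else (\<lambda>z. x < z)) a v"

text \<open>
  This is the mirror image of Foata's second fundamental transformation: words grow by adding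
  letters at the front, and the roles of small and large letters are exchanged.
  The mirror image is taken because it leads to \<open>rev_major\<close> instead of the major index.
\<close>

fun foata :: "'a::linorder list \<Rightarrow> 'a list" where
  "foata [] = []"
| "foata (x # v) = x # foata_turn x (foata v)"

fun inversions :: "'a::linorder list \<Rightarrow> nat" where
  "inversions [] = 0"
| "inversions (x # v) = length (filter (\<lambda>z. z < x) v) + inversions v"

text \<open>
  For a word of length \<open>n\<close> this is the sum of \<open>n - i\<close> over the descents \<open>i\<close>; the weights can be
  read off in a recursion from the left because \<open>n - i\<close> is the length of the word after position
  \<open>i\<close>.
\<close>

fun rev_major :: "'a::linorder list \<Rightarrow> nat" where
  "rev_major [] = 0"
| "rev_major [x] = 0"
| "rev_major (x # y # v) = (if y < x then length (y # v) else 0) + rev_major (y # v)"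

fun lr_minima :: "'a::linorder list \<Rightarrow> 'a list" where
  "lr_minima [] = []"
| "lr_minima (x # v) = x # filter (\<lambda>z. z < x) (lr_minima v)"

lemma mset_slide: "mset (slide P a v) = mset (a # v)"
  by (induction v arbitrary: a) auto

lemma length_slide: "length (slide P a v) = Suc (length v)"
  by (metis mset_slide size_mset length_Cons)

lemma length_filter_slide: "length (filter Q (slide P a v)) = length (filter Q (a # v))"
  by (metis mset_slide mset_filter size_mset)

lemma last_slide: "P a \<Longrightarrow> P (last (slide P a v))"
proof (induction v arbitrary: a)
  case (Cons b v)
  have "slide P c v \<noteq> []" for c
    by (metis length_slide list.size(3) nat.distinct(1))
  with Cons show ?case by auto
qed auto

text \<open>
  If the first letter of the result satisfies \<open>P\<close>, it is the letter in hand and has just been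
  exchanged; otherwise it is a letter that was passed.  So sliding can be undone letter by
  letter.
\<close>

lemma slide_inject:
  "P a \<Longrightarrow> P b \<Longrightarrow> slide P a v = slide P b w \<Longrightarrow> a # v = b # w"
proof (induction v arbitrary: a b w)
  case Nil
  then have "length w = 0"
    by (metis length_slide list.size(3) nat.inject)
  with Nil show ?case by simp
next
  case (Cons c v)
  from Cons.prems(3) have "length (c # v) = length w"
    by (metis length_slide nat.inject)
  then obtain d w' where w: "w = d # w'"
    by (cases w) auto
  show ?case
    using Cons.prems Cons.IH[of c d w'] Cons.IH[of a b w'] unfolding w
    by (auto split: if_splits)
qed

lemma filter_slide_movable: "P a \<Longrightarrow> filter P (slide P a v) = filter P (a # v)"
  by (induction v arbitrary: a) auto

lemma filter_slide_others:
  "P a \<Longrightarrow> filter (\<lambda>z. \<not> P z) (slide P a v) = filter (\<lambda>z. \<not> P z) (a # v)"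
  by (induction v arbitrary: a) auto

lemma mset_foata_turn: "mset (foata_turn x u) = mset u"
  by (cases u) (simp_all add: mset_slide)

lemma set_foata_turn: "set (foata_turn x u) = set u"
  by (metis mset_foata_turn set_mset_mset)

lemma length_foata_turn: "length (foata_turn x u) = length u"
  by (metis mset_foata_turn size_mset)

lemma mset_foata: "mset (foata xs) = mset xs"
  by (induction xs) (simp_all add: mset_foata_turn)

lemma set_foata: "set (foata xs) = set xs"
  by (metis mset_foata set_mset_mset)

lemma distinct_foata: "distinct (foata xs) = distinct xs"
  by (metis mset_foata mset_eq_imp_distinct_iff)

text \<open>
  Letters only jump over letters on the other side of \<open>x\<close>, so the letters below \<open>x\<close> keep their
  order, and so do those above \<open>x\<close>.  This is why both inverse descents and left-to-right minima
  survive the transformation.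
\<close>

lemma filter_foata_turn:
  assumes "x \<notin> set u"
    and "(\<forall>z\<in>set u. Q z \<longrightarrow> z < x) \<or> (\<forall>z\<in>set u. Q z \<longrightarrow> x < z)"
  shows "filter Q (foata_turn x u) = filter Q u"
proof (cases u)
  case (Cons a v)
  define P where "P = (if a < x then (\<lambda>z. z < x) else (\<lambda>z. x < z))"
  have turn: "foata_turn x u = slide P a v"
    by (simp add: Cons P_def)
  have "P a" using assms(1) by (auto simp: P_def Cons)
  have *: "filter R (slide P a v) = filter R u" if "R = P \<or> R = (\<lambda>z. \<not> P z)" for R
    using that filter_slide_movable[of P a v] filter_slide_others[of P a v] \<open>P a\<close> Cons by auto
  have "(\<forall>z\<in>set u. Q z \<longrightarrow> P z) \<or> (\<forall>z\<in>set u. Q z \<longrightarrow> \<not> P z)"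
    using assms(2) unfolding P_def by (auto dest: less_asym)
  then obtain R where R: "R = P \<or> R = (\<lambda>z. \<not> P z)" and QR: "\<forall>z\<in>set u. Q z \<longrightarrow> R z"
    by blast
  have same: "filter Q ys = filter Q (filter R ys)" if "set ys = set u" for ys
    using QR that by (auto intro!: filter_cong)
  have "set (slide P a v) = set u"
    using set_foata_turn[of x u] turn by simp
  then have "filter Q (slide P a v) = filter Q (filter R (slide P a v))"
    by (rule same)
  also have "\<dots> = filter Q u"
    using *[OF R] same[of u] by simp
  finally show ?thesis by (simp add: turn)
qed simp

lemma foata_turn_inject:
  assumes "x \<notin> set u" "x \<notin> set u'" "foata_turn x u = foata_turn x u'"
  shows "u = u'"
proof (cases u)
  case Nil
  then show ?thesis using assms(3) by (metis length_foata_turn length_0_conv)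
next
  case (Cons a v)
  then have "length u' \<noteq> 0"
    using assms(3) by (metis length_foata_turn length_0_conv list.discI)
  then obtain b w where u': "u' = b # w" by (cases u') auto
  define P where "P c = (if c < x then (\<lambda>z. z < x) else (\<lambda>z. x < z))" for c
  have eq: "slide (P a) a v = slide (P b) b w"
    using assms(3) by (simp add: Cons u' P_def)
  have "P a a" "P b b" using assms(1,2) by (auto simp: P_def Cons u')
  \<comment> \<open>The last letter of the turned word tells which of the two cases was applied.\<close>
  then have "P a (last (slide (P a) a v))" "P b (last (slide (P a) a v))"
    using last_slide[of "P a" a v] last_slide[of "P b" b w] eq by auto
  then have "P a = P b"
    by (auto simp: P_def split: if_splits)
  then have "a # v = b # w"
    using slide_inject[of "P a" a b v w] eq \<open>P a a\<close> \<open>P b b\<close> by simp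
  then show ?thesis by (simp add: Cons u')
qed

lemma foata_inject:
  "distinct xs \<Longrightarrow> distinct ys \<Longrightarrow> foata xs = foata ys \<Longrightarrow> xs = ys"
proof (induction xs arbitrary: ys)
  case Nil
  then show ?case by (cases ys) auto
next
  case (Cons x v)
  then obtain w where w: "ys = x # w" by (cases ys) auto
  with Cons.prems have "foata_turn x (foata v) = foata_turn x (foata w)" by simp
  moreover have "x \<notin> set (foata v)" "x \<notin> set (foata w)"
    using Cons.prems by (auto simp: w set_foata)
  ultimately have "foata v = foata w" by (metis foata_turn_inject)
  with Cons w show ?case by auto
qed

lemma bij_betw_foata:
  assumes "finite A"
  shows "bij_betw foata (permutations_of_set A) (permutations_of_set A)"
proof -
  have "inj_on foata (permutations_of_set A)"
    by (auto intro!: inj_onI foata_inject dest: permutations_of_setD)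
  moreover have "foata ` permutations_of_set A \<subseteq> permutations_of_set A"
    by (auto intro!: permutations_of_setI dest: permutations_of_setD
             simp: set_foata distinct_foata)
  ultimately show ?thesis
    using assms by (simp add: bij_betw_def endo_inj_surj)
qed

text \<open>
  Every letter above \<open>x\<close> is passed by exactly one letter below \<open>x\<close>, which then stands to its right:
  each passage creates one inversion.  For large letters on the move each passage destroys one.
\<close>

lemma inversions_slide_small:
  assumes "a < x" "x \<notin> set v"
  shows "inversions (slide (\<lambda>z. z < x) a v)
       = inversions (a # v) + length (filter (\<lambda>z. x < z) v)"
  using assms
proof (induction v arbitrary: a)
  case (Cons b v)
  show ?case using Cons by (auto simp: length_filter_slide)
qed simp

lemma inversions_slide_large:
  assumes "x < a" "x \<notin> set v"
  shows "inversions (slide (\<lambda>z. x < z) a v) + length (filter (\<lambda>z. z < x) v)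
       = inversions (a # v)"
  using assms
proof (induction v arbitrary: a)
  case (Cons b v)
  have "b < x \<Longrightarrow> \<not> a < b" using Cons.prems by auto
  then show ?case using Cons.IH[of a] Cons.IH[of b] Cons.prems by (auto simp: length_filter_slide)
qed simp

text \<open>
  Let \<open>y\<close> be the first letter of the word before \<open>x\<close> is added; the transformation keeps it in
  front.  The new letter \<open>x\<close> adds one inversion for each smaller letter.  If \<open>y < x\<close>, the slide
  adds one more for each larger letter, in total the length of the word, as for a new descent;
  if \<open>x < y\<close>, the slide removes the inversions that \<open>x\<close> adds.
\<close>

lemma inversions_foata: "distinct xs \<Longrightarrow> inversions (foata xs) = rev_major xs"
proof (induction xs rule: rev_major.induct)
  case (3 x y v)
  define u where "u = foata_turn y (foata v)"
  have fy: "foata (y # v) = y # u" by (simp add: u_def)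
  have IH: "inversions (y # u) = rev_major (y # v)"
    using 3 fy by simp
  have su: "set u = set v" and lu: "length u = length v"
    by (simp_all add: u_def set_foata_turn set_foata)
       (metis length_foata_turn mset_foata size_mset)
  have xu: "x \<notin> set u" "x \<noteq> y" using 3(2) su by auto
  have split: "length (filter (\<lambda>z. z < x) u) + length (filter (\<lambda>z. x < z) u) = length u"
  proof -
    have "filter (\<lambda>z. x < z) u = filter (\<lambda>z. \<not> z < x) u"
      using xu by (intro filter_cong) (auto simp: not_less le_less)
    then show ?thesis by (simp add: sum_length_filter_compl)
  qed
  show ?case
  proof (cases "y < x")
    case True
    then show ?thesis
      using inversions_slide_small[of y x u] xu IH split lu
      by (simp add: fy length_filter_slide del: foata.simps(2)) (simp add: fy[simplified] length_filter_slide)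
  next
    case False
    then have "x < y" using xu by auto
    with False show ?thesis
      using inversions_slide_large[of x y u] xu IH
      by (simp add: fy[simplified] length_filter_slide)
  qed
qed simp_all

text \<open>
  A third value \<open>x\<close> never lies between two adjacent values, so turning at \<open>x\<close> keeps their relative
  order; and if \<open>x\<close> is one of the two, it is in front before and after.
\<close>

lemma filter_adjacent_foata:
  fixes xs :: "nat list"
  assumes "distinct xs"
  shows "filter (\<lambda>z. z = i \<or> z = Suc i) (foata xs) = filter (\<lambda>z. z = i \<or> z = Suc i) xs"
  using assms
proof (induction xs)
  case (Cons x v)
  have "x \<notin> set (foata v)" using Cons.prems by (simp add: set_foata)
  moreover from this have "(\<forall>z\<in>set (foata v). z = i \<or> z = Suc i \<longrightarrow> z < x) \<or>
        (\<forall>z\<in>set (foata v). z = i \<or> z = Suc i \<longrightarrow> x < z)"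
    by (metis less_Suc_eq linorder_neqE_nat not_less_eq)
  ultimately have "filter (\<lambda>z. z = i \<or> z = Suc i) (foata_turn x (foata v))
      = filter (\<lambda>z. z = i \<or> z = Suc i) (foata v)"
    by (rule filter_foata_turn)
  with Cons show ?case by simp
qed simp

lemma lr_minima_filter_less:
  "lr_minima (filter (\<lambda>z. z < x) v) = filter (\<lambda>z. z < x) (lr_minima v)"
proof (induction v)
  case (Cons a v)
  then show ?case by (auto intro!: filter_cong simp: conj_commute)
qed simp

lemma lr_minima_foata: "distinct xs \<Longrightarrow> lr_minima (foata xs) = lr_minima xs"
proof (induction xs)
  case (Cons x v)
  have "filter (\<lambda>z. z < x) (foata_turn x (foata v)) = filter (\<lambda>z. z < x) (foata v)"
    using Cons.prems by (intro filter_foata_turn) (auto simp: set_foata)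
  then show ?case
    using Cons by (metis distinct.simps(2) foata.simps(2) lr_minima.simps(2) lr_minima_filter_less)
qed simp

section \<open>Excess function and Lehmer code\<close>

definition lehmer :: "(nat \<Rightarrow> nat) \<Rightarrow> nat \<Rightarrow> nat" where
  "lehmer p i = card {j. 1 \<le> j \<and> j < i \<and> p j > p i}"

text \<open>
  In contrast to the Lehmer code, the excess function transforms simply under inversion of
  permutations (\<open>excess_inv\<close>); the code is its restriction to the graph of the permutation
  (\<open>lehmer_eq_excess\<close>).
\<close>

definition excess :: "(nat \<Rightarrow> nat) \<Rightarrow> nat \<Rightarrow> nat \<Rightarrow> nat" where
  "excess p a b = card {j. 1 \<le> j \<and> j \<le> a \<and> b < p j}"

lemma excess_0: "excess p 0 b = 0"
  by (simp add: excess_def)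

lemma excess_Suc: "excess p (Suc a) b = excess p a b + (if b < p (Suc a) then 1 else 0)"
proof -
  have "{j. 1 \<le> j \<and> j \<le> Suc a \<and> b < p j}
      = (if b < p (Suc a) then insert (Suc a) else id) {j. 1 \<le> j \<and> j \<le> a \<and> b < p j}"
    by (auto simp: le_Suc_eq)
  then show ?thesis by (simp add: excess_def)
qed

lemma excess_antimono: "b \<le> b' \<Longrightarrow> excess p a b' \<le> excess p a b"
  unfolding excess_def by (intro card_mono) auto

lemma excess_less:
  assumes "1 \<le> a" "b < p a"
  shows "excess p a (p a) < excess p a b"
proof -
  obtain a' where a: "a = Suc a'" using assms(1) by (cases a) auto
  have "excess p a' (p a) \<le> excess p a' b"
    using assms by (intro excess_antimono) simp
  then show ?thesis using assms by (simp add: a excess_Suc)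
qed

lemma excess_le_Suc:
  assumes "inj p"
  shows "excess p a b \<le> Suc (excess p a (Suc b))"
proof -
  let ?A = "{j. 1 \<le> j \<and> j \<le> a \<and> Suc b < p j}"
  have "j = inv p (Suc b)" if "p j = Suc b" for j
    using inv_f_eq[OF assms that] by simp
  moreover have "Suc b < p j \<or> p j = Suc b" if "b < p j" for j
    using that by auto
  ultimately have "{j. 1 \<le> j \<and> j \<le> a \<and> b < p j} \<subseteq> insert (inv p (Suc b)) ?A"
    by blast
  then have "excess p a b \<le> card (insert (inv p (Suc b)) ?A)"
    unfolding excess_def by (intro card_mono) auto
  also have "\<dots> \<le> Suc (card ?A)"
    by (simp add: card_insert_if)
  finally show ?thesis by (simp add: excess_def)
qed

lemma lehmer_eq_excess: "lehmer p i = excess p i (p i)"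
  unfolding lehmer_def excess_def by (rule arg_cong[where f = card]) (auto simp: le_less)

lemma card_le_plus_excess:
  "card {j. 1 \<le> j \<and> j \<le> a \<and> p j \<le> b} + excess p a b = a"
proof -
  have "card {j. 1 \<le> j \<and> j \<le> a \<and> p j \<le> b} + excess p a b
      = card ({j. 1 \<le> j \<and> j \<le> a \<and> p j \<le> b} \<union> {j. 1 \<le> j \<and> j \<le> a \<and> b < p j})"
    unfolding excess_def by (intro card_Un_disjoint[symmetric]) auto
  also have "{j. 1 \<le> j \<and> j \<le> a \<and> p j \<le> b} \<union> {j. 1 \<le> j \<and> j \<le> a \<and> b < p j} = {1..a}"
    by auto
  finally show ?thesis by simp
qed

text \<open>
  The positions up to \<open>a\<close> with values up to \<open>b\<close> correspond to the values up to \<open>b\<close> at positions up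
  to \<open>a\<close>, and the two excesses complement this common number to \<open>a\<close> and to \<open>b\<close>.
\<close>

lemma excess_inv:
  assumes p: "p permutes {1..m}" and ab: "a \<le> m" "b \<le> m"
  shows "excess (inv p) b a + a = excess p a b + b"
proof -
  have "bij_betw p {j. 1 \<le> j \<and> j \<le> a \<and> p j \<le> b} {i. 1 \<le> i \<and> i \<le> b \<and> inv p i \<le> a}"
  proof (rule bij_betwI[where g = "inv p"])
    show "p \<in> {j. 1 \<le> j \<and> j \<le> a \<and> p j \<le> b} \<rightarrow> {i. 1 \<le> i \<and> i \<le> b \<and> inv p i \<le> a}"
      using ab permutes_in_seg[OF p] by (auto simp: permutes_inverses[OF p])
    show "inv p \<in> {i. 1 \<le> i \<and> i \<le> b \<and> inv p i \<le> a} \<rightarrow> {j. 1 \<le> j \<and> j \<le> a \<and> p j \<le> b}"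
      using ab permutes_in_seg[OF permutes_inv[OF p]] by (auto simp: permutes_inverses[OF p])
  qed (auto simp: permutes_inverses[OF p])
  then have "card {j. 1 \<le> j \<and> j \<le> a \<and> p j \<le> b} = card {i. 1 \<le> i \<and> i \<le> b \<and> inv p i \<le> a}"
    by (rule bij_betw_same_card)
  then show ?thesis
    using card_le_plus_excess[of a p b] card_le_plus_excess[of b "inv p" a] by linarith
qed

lemma excess_lower:
  assumes "p permutes {1..m}" "a \<le> m" "b \<le> m"
  shows "a \<le> excess p a b + b"
  using excess_inv[OF assms] by linarith

lemma excess_above:
  assumes p: "p permutes {1..m}" and "a \<le> m"
  shows "excess p a m = 0"
proof -
  have "{j. 1 \<le> j \<and> j \<le> a \<and> m < p j} = {}"
    using permutes_in_seg[OF p] \<open>a \<le> m\<close> by fastforce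
  then show ?thesis by (simp only: excess_def card.empty)
qed

lemma permutes_eqI_excess:
  assumes u: "u permutes {1..n}" and w: "w permutes {1..n}"
    and eq: "\<And>k l. k \<le> n \<Longrightarrow> l \<le> n \<Longrightarrow> excess u k l = excess w k l"
  shows "u = w"
proof
  fix k
  show "u k = w k"
  proof (cases "k \<in> {1..n}")
    case True
    then obtain k' where k: "k = Suc k'" by (cases k) auto
    have "l < u k \<longleftrightarrow> l < w k" if "l \<le> n" for l
      using eq[of k l] eq[of k' l] that True by (simp add: k excess_Suc split: if_splits)
    from this[of "u k"] this[of "w k"] show ?thesis
      using permutes_in_seg[OF u True] permutes_in_seg[OF w True] by auto
  next
    case False
    then show ?thesis using u w by (metis permutes_not_in)
  qed
qed

text \<open>
  Going down from position \<open>n\<close>, the excess functions of \<open>u\<close> and \<open>w\<close> at the current position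
  agree.  Their common excess strictly decreases across each value taken there, so equal code
  entries force equal values, and the agreement extends to the preceding position.
\<close>

lemma lehmer_inject:
  assumes u: "u permutes {1..n}" and w: "w permutes {1..n}"
    and eq: "\<And>i. i \<in> {1..n} \<Longrightarrow> lehmer u i = lehmer w i"
  shows "u = w"
proof -
  have "\<forall>b\<le>n. excess u a b = excess w a b" if "a \<le> n" for a
    using that
  proof (induction rule: inc_induct)
    case base
    show ?case
    proof (intro allI impI)
      fix b assume b: "b \<le> n"
      have "excess (inv p) b n = 0" if "p permutes {1..n}" for p
        using excess_above[OF permutes_inv[OF that] b] .
      then show "excess u n b = excess w n b"
        using excess_inv[OF u order.refl b] excess_inv[OF w order.refl b] u w by simp
    qed
  next
    case (step a)
    have a: "Suc a \<in> {1..n}" using step.hyps by auto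
    have range: "u (Suc a) \<le> n" "w (Suc a) \<le> n"
      using permutes_in_seg[OF u a] permutes_in_seg[OF w a] by auto
    have "excess u (Suc a) (u (Suc a)) = excess w (Suc a) (w (Suc a))"
      using eq[OF a] by (simp add: lehmer_eq_excess)
    then have "u (Suc a) = w (Suc a)"
      using excess_less[of "Suc a" "u (Suc a)" w] excess_less[of "Suc a" "w (Suc a)" u]
        step.IH range by (cases "u (Suc a)" "w (Suc a)" rule: linorder_cases) auto
    then show ?case using step.IH by (auto simp: excess_Suc)
  qed
  then show ?thesis by (intro permutes_eqI_excess[OF u w]) auto
qed

lemma lehmer_less: "1 \<le> i \<Longrightarrow> lehmer p i < i"
proof -
  assume "1 \<le> i"
  have "lehmer p i \<le> card {1..<i}"
    unfolding lehmer_def by (intro card_mono) auto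
  with \<open>1 \<le> i\<close> show ?thesis by simp
qed

text \<open>
  Injectivity suffices, since there are \<open>fact m\<close> codes.
\<close>

lemma bij_betw_lehmer:
  "bij_betw (\<lambda>p. restrict (lehmer p) {1..m}) {p. p permutes {1..m}} (\<Pi>\<^sub>E i\<in>{1..m}. {..<i})"
proof -
  let ?C = "\<lambda>p. restrict (lehmer p) {1..m}"
  let ?S = "{p. p permutes {1..m}}"
  have inj: "inj_on ?C ?S"
  proof (rule inj_onI)
    fix u w assume "u \<in> ?S" "w \<in> ?S" "?C u = ?C w"
    then show "u = w"
      using lehmer_inject[of u m w] by (metis mem_Collect_eq restrict_apply')
  qed
  have sub: "?C ` ?S \<subseteq> (\<Pi>\<^sub>E i\<in>{1..m}. {..<i})"
    by (auto simp: lehmer_less)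
  have "card (\<Pi>\<^sub>E i\<in>{1..m}. {..<i}) = fact m"
    by (simp add: card_PiE fact_prod)
  moreover have "card (?C ` ?S) = fact m"
    using card_image[OF inj] by (simp add: card_permutations[OF refl])
  ultimately have "?C ` ?S = (\<Pi>\<^sub>E i\<in>{1..m}. {..<i})"
    using sub by (intro card_subset_eq) (auto intro: finite_PiE)
  with inj show ?thesis by (simp add: bij_betw_def)
qed

lemma descent_iff_lehmer:
  assumes "inj p" "1 \<le> i"
  shows "p (Suc i) < p i \<longleftrightarrow> lehmer p i < lehmer p (Suc i)"
proof
  assume less: "p (Suc i) < p i"
  have "insert i {j. 1 \<le> j \<and> j < i \<and> p i < p j} \<subseteq> {j. 1 \<le> j \<and> j < Suc i \<and> p (Suc i) < p j}"
    using less assms(2) by auto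
  then have "card (insert i {j. 1 \<le> j \<and> j < i \<and> p i < p j}) \<le> lehmer p (Suc i)"
    unfolding lehmer_def by (intro card_mono) auto
  then show "lehmer p i < lehmer p (Suc i)"
    unfolding lehmer_def[of p i] by simp
next
  assume *: "lehmer p i < lehmer p (Suc i)"
  show "p (Suc i) < p i"
  proof (rule ccontr)
    assume "\<not> p (Suc i) < p i"
    then have "{j. 1 \<le> j \<and> j < Suc i \<and> p (Suc i) < p j} \<subseteq> {j. 1 \<le> j \<and> j < i \<and> p i < p j}"
      by (auto simp: less_Suc_eq)
    then have "lehmer p (Suc i) \<le> lehmer p i"
      unfolding lehmer_def by (intro card_mono) auto
    with * show False by simp
  qed
qed

section \<open>Collapsing a permutation\<close>

text \<open>
  For a permutation \<open>p\<close> of \<open>{1..n + d}\<close> this is the permutation \<open>w\<close> of \<open>{1..n}\<close> with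
  \<open>excess w k l = min k (excess p (k + d) (l + d))\<close> (lemma \<open>excess_collapse\<close>).  Differencing the
  right-hand side in \<open>k\<close> tells for which \<open>l\<close> the value \<open>w k\<close> has to exceed \<open>l\<close>, and \<open>w k\<close> is
  the number of these \<open>l\<close>.  The truncation is the same on both axes, because passing to the
  inverse changes the excess at \<open>(k, l)\<close> by \<open>l - k\<close> and turns \<open>min k\<close> into \<open>min l\<close>.
\<close>

definition collapse :: "nat \<Rightarrow> nat \<Rightarrow> (nat \<Rightarrow> nat) \<Rightarrow> nat \<Rightarrow> nat" where
  "collapse d n p k =
     (if 1 \<le> k \<and> k \<le> n
      then card {l. l < n \<and> (l + d < p (k + d) \<or> k \<le> excess p (k + d) (l + d))}
      else k)"

lemma less_card_downset_iff:
  fixes n :: nat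
  assumes down: "\<And>l l'. Q l' \<Longrightarrow> l \<le> l' \<Longrightarrow> Q l" and "\<not> Q n"
  shows "l < card {l. l < n \<and> Q l} \<longleftrightarrow> Q l"
proof -
  define c where "c = (LEAST l. \<not> Q l)"
  have "\<not> Q c"
    unfolding c_def using \<open>\<not> Q n\<close> by (rule LeastI)
  then have c: "Q l \<longleftrightarrow> l < c" for l
    using not_less_Least[of l "\<lambda>l. \<not> Q l"] down[of l c] by (auto simp: c_def not_less[symmetric])
  have "\<not> n < c" using c[of n] \<open>\<not> Q n\<close> by simp
  then have "{l. l < n \<and> Q l} = {..<c}"
    by (auto simp: c)
  with c show ?thesis by simp
qed

context
  fixes d n :: nat and p :: "nat \<Rightarrow> nat"
  assumes p: "p permutes {1..n + d}"
begin

lemma less_collapse_iff: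
  assumes k: "1 \<le> k" "k \<le> n"
  shows "l < collapse d n p k \<longleftrightarrow> l + d < p (k + d) \<or> k \<le> excess p (k + d) (l + d)"
proof -
  let ?Q = "\<lambda>l. l + d < p (k + d) \<or> k \<le> excess p (k + d) (l + d)"
  have "\<not> ?Q n"
    using permutes_in_seg[OF p, of "k + d"] excess_above[OF p, of "k + d"] k by auto
  moreover have "?Q l" if "?Q l'" "l \<le> l'" for l l'
    using that excess_antimono[of "l + d" "l' + d" p "k + d"] by auto
  ultimately have "l < card {l. l < n \<and> ?Q l} \<longleftrightarrow> ?Q l"
    by (intro less_card_downset_iff) blast+
  then show ?thesis using k by (simp add: collapse_def)
qed

lemma collapse_range:
  assumes k: "1 \<le> k" "k \<le> n"
  shows "1 \<le> collapse d n p k" "collapse d n p k \<le> n"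
proof -
  have "0 < collapse d n p k"
    using less_collapse_iff[OF k, of 0] excess_lower[OF p, of "k + d" d] k by auto
  then show "1 \<le> collapse d n p k" by simp
  have "\<not> n < collapse d n p k"
    using less_collapse_iff[OF k, of n] permutes_in_seg[OF p, of "k + d"]
      excess_above[OF p, of "k + d"] k by auto
  then show "collapse d n p k \<le> n" by simp
qed

lemma excess_collapse:
  "k \<le> n \<Longrightarrow> excess (collapse d n p) k l = min k (excess p (k + d) (l + d))"
proof (induction k)
  case (Suc k)
  then show ?case
    using less_collapse_iff[of "Suc k" l] by (auto simp: excess_Suc min_def)
qed (simp add: excess_0)

text \<open>
  The excess over all \<open>n\<close> positions is \<open>n - l\<close>, so it drops by one from \<open>l = v - 1\<close> to \<open>l = v\<close>, which
  forces the value \<open>v\<close> to be taken.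
\<close>

lemma collapse_permutes: "collapse d n p permutes {1..n}"
proof (rule bij_imp_permutes)
  show "collapse d n p k = k" if "k \<notin> {1..n}" for k
    using that by (auto simp: collapse_def)
  have "v \<in> collapse d n p ` {1..n}" if v: "v \<in> {1..n}" for v
  proof (rule ccontr)
    assume none: "v \<notin> collapse d n p ` {1..n}"
    have top: "excess (collapse d n p) n l = n - l" if "l \<le> n" for l
    proof -
      have "excess p (n + d) (l + d) + (l + d) = n + d"
        using excess_inv[OF p order.refl, of "l + d"]
          excess_above[OF permutes_inv[OF p], of "l + d"] that by simp
      then show ?thesis by (simp add: excess_collapse)
    qed
    have "v - 1 < collapse d n p j \<longleftrightarrow> v < collapse d n p j" if "1 \<le> j" "j \<le> n" for j
    proof -
      have "collapse d n p j \<noteq> v" using none that by auto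
      then show ?thesis using v by auto
    qed
    then have "excess (collapse d n p) n (v - 1) = excess (collapse d n p) n v"
      unfolding excess_def by (intro arg_cong[where f = card]) auto
    moreover have "1 \<le> v" "v \<le> n" "v - 1 \<le> n" using v by auto
    ultimately show False using top[of v] top[of "v - 1"] by linarith
  qed
  moreover have "collapse d n p ` {1..n} \<subseteq> {1..n}"
    using collapse_range by auto
  ultimately have "collapse d n p ` {1..n} = {1..n}" by blast
  then show "bij_betw (collapse d n p) {1..n} {1..n}"
    by (simp add: bij_betw_def eq_card_imp_inj_on)
qed

text \<open>
  If the collapsed value is \<open>p (k + d) - d\<close>, then the code entry of \<open>p\<close> is below \<open>k\<close> and is
  copied.  Otherwise the collapsed value is larger, which happens only because the code entry of
  \<open>p\<close> is at least \<open>k\<close>; then position \<open>k\<close> becomes a left-to-right minimum, with the maximal entry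
  \<open>k - 1\<close>.
\<close>

lemma lehmer_collapse:
  assumes k: "1 \<le> k" "k \<le> n"
  shows "lehmer (collapse d n p) k = min (k - 1) (lehmer p (k + d))"
proof -
  define v where "v = collapse d n p k"
  have "1 \<le> v" using collapse_range(1)[OF k] by (simp add: v_def)
  then obtain v' where v': "v = Suc v'" by (cases v) auto
  have upper: "p (k + d) \<le> v + d" "excess p (k + d) (v + d) < k"
    using less_collapse_iff[OF k, of v] by (auto simp: v_def not_less not_le)
  have lower: "v' + d < p (k + d) \<or> k \<le> excess p (k + d) (v' + d)"
    using less_collapse_iff[OF k, of v'] v' by (simp add: v_def)
  have code: "lehmer (collapse d n p) k = excess p (k + d) (v + d)"
    using excess_collapse[OF k(2), of v] upper(2) by (simp add: lehmer_eq_excess v_def)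
  show ?thesis
  proof (cases "p (k + d) = v + d")
    case True
    then show ?thesis using code upper(2) by (simp add: lehmer_eq_excess)
  next
    case False
    then have "p (k + d) \<le> v' + d" and big: "k \<le> excess p (k + d) (v' + d)"
      using upper(1) lower v' by auto
    then have "k \<le> lehmer p (k + d)"
      using excess_antimono[of "p (k + d)" "v' + d" p "k + d"] by (simp add: lehmer_eq_excess)
    moreover have "excess p (k + d) (v + d) = k - 1"
      using big upper(2) excess_le_Suc[OF permutes_inj[OF p], of "k + d" "v' + d"] v' by simp
    ultimately show ?thesis using code by simp
  qed
qed

end

text \<open>
  The reason for describing the collapse by excesses: the code of an inverse is not visible
  from the code, while \<open>excess_inv\<close> carries one truncated excess function to the other.
\<close>

lemma collapse_inv:
  assumes p: "p permutes {1..n + d}"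
  shows "collapse d n (inv p) = inv (collapse d n p)"
proof (rule permutes_eqI_excess)
  note w = collapse_permutes[OF p]
  show "collapse d n (inv p) permutes {1..n}"
    by (rule collapse_permutes[OF permutes_inv[OF p]])
  show "inv (collapse d n p) permutes {1..n}"
    by (rule permutes_inv[OF w])
  fix l k assume lk: "l \<le> n" "k \<le> n"
  have "excess (inv (collapse d n p)) l k + k = min k (excess p (k + d) (l + d)) + l"
    using excess_inv[OF w lk(2,1)] excess_collapse[OF p lk(2)] by simp
  moreover have "excess (inv p) (l + d) (k + d) + k = excess p (k + d) (l + d) + l"
    using excess_inv[OF p, of "k + d" "l + d"] lk by simp
  moreover have "excess (collapse d n (inv p)) l k = min l (excess (inv p) (l + d) (k + d))"
    by (rule excess_collapse[OF permutes_inv[OF p] lk(1)])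
  ultimately show "excess (collapse d n (inv p)) l k = excess (inv (collapse d n p)) l k"
    by linarith
qed

section \<open>Statistics and fibers of the collapse\<close>

definition descents :: "nat \<Rightarrow> (nat \<Rightarrow> nat) \<Rightarrow> nat set" where
  "descents n w = {k. 1 \<le> k \<and> k < n \<and> w (Suc k) < w k}"

text \<open>
  The entry \<open>lehmer w k\<close> is \<open>k - 1\<close> exactly when all earlier values exceed \<open>w k\<close>, so this is the
  number of left-to-right minima.
\<close>

definition minima_count :: "nat \<Rightarrow> (nat \<Rightarrow> nat) \<Rightarrow> nat" where
  "minima_count n w = card {k \<in> {1..n}. lehmer w k = k - 1}"

text \<open>
  A permutation lies above \<open>w\<close> iff each of its code entries truncates to the given one.  The first
  \<open>d\<close> entries are unconstrained, which gives \<open>fact d\<close>.  An entry that becomes \<open>c < k - 1\<close> must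
  equal \<open>c\<close>, but one that becomes \<open>k - 1\<close> may be any of \<open>k - 1, \<dots>, k + d - 1\<close>.
\<close>

lemma card_fiber_collapse:
  assumes w: "w permutes {1..n}"
  shows "card {p. p permutes {1..n + d} \<and> collapse d n p = w}
       = fact d * Suc d ^ minima_count n w"
proof -
  define B where "B i = {c. c < i \<and> (d < i \<longrightarrow> min (i - d - 1) c = lehmer w (i - d))}" for i
  let ?C = "\<lambda>p. restrict (lehmer p) {1..n + d}"
  let ?F = "{p. p permutes {1..n + d} \<and> collapse d n p = w}"
  have fiber_iff: "collapse d n p = w \<longleftrightarrow> ?C p \<in> PiE {1..n + d} B"
    if p: "p permutes {1..n + d}" for p
  proof
    assume "collapse d n p = w"
    then show "?C p \<in> PiE {1..n + d} B"
      using lehmer_collapse[OF p] by (auto simp: B_def lehmer_less)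
  next
    assume C: "?C p \<in> PiE {1..n + d} B"
    show "collapse d n p = w"
    proof (rule lehmer_inject[OF collapse_permutes[OF p] w])
      fix k assume k: "k \<in> {1..n}"
      then have "lehmer p (k + d) \<in> B (k + d)"
        using C by (auto dest: PiE_mem[of _ _ _ "k + d"])
      then show "lehmer (collapse d n p) k = lehmer w k"
        using lehmer_collapse[OF p, of k] k by (auto simp: B_def)
    qed
  qed
  have "bij_betw ?C ?F (PiE {1..n + d} B)"
    unfolding bij_betw_def
  proof
    show "inj_on ?C ?F"
      by (rule inj_on_subset[OF bij_betw_imp_inj_on[OF bij_betw_lehmer]]) auto
    have "PiE {1..n + d} B \<subseteq> (\<Pi>\<^sub>E i\<in>{1..n + d}. {..<i})"
      by (rule PiE_mono) (auto simp: B_def)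
    then have "PiE {1..n + d} B \<subseteq> ?C ` {p. p permutes {1..n + d}}"
      using bij_betw_imp_surj_on[OF bij_betw_lehmer, of "n + d"] by simp
    then show "?C ` ?F = PiE {1..n + d} B"
      using fiber_iff by blast
  qed
  then have "card ?F = (\<Prod>i\<in>{1..n + d}. card (B i))"
    by (simp add: bij_betw_same_card card_PiE)
  also have "\<dots> = (\<Prod>i=1..d. card (B i)) * (\<Prod>k=1..n. card (B (k + d)))"
    using prod.ub_add_nat[of 1 d "\<lambda>i. card (B i)" n]
      prod.shift_bounds_cl_nat_ivl[of "\<lambda>i. card (B i)" 1 d n]
    by (simp add: add.commute)
  also have "(\<Prod>i=1..d. card (B i)) = fact d"
  proof -
    have "B i = {..<i}" if "i \<in> {1..d}" for i using that by (auto simp: B_def)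
    then show ?thesis by (simp add: fact_prod)
  qed
  also have "(\<Prod>k=1..n. card (B (k + d))) = (\<Prod>k=1..n. if lehmer w k = k - 1 then Suc d else 1)"
  proof (rule prod.cong[OF refl])
    fix k assume "k \<in> {1..n}"
    then have "lehmer w k < k" by (simp add: lehmer_less)
    then have "B (k + d) = (if lehmer w k = k - 1 then {k - 1..<k + d} else {lehmer w k})"
      by (auto simp: B_def min_def split: if_splits)
    then show "card (B (k + d)) = (if lehmer w k = k - 1 then Suc d else 1)"
      using \<open>k \<in> {1..n}\<close> by auto
  qed
  also have "\<dots> = Suc d ^ minima_count n w"
    by (simp add: prod.If_cases minima_count_def Int_def)
  finally show ?thesis .
qed

text \<open>
  The \<open>q\<close>-statistics, with \<open>q = d + 1\<close>, are the ordinary ones of the collapsed permutation: the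
  minimum in the \<open>q\<close>-inversion number is the truncation of the code, and the clause about \<open>Del_q\<close>
  in the \<open>q\<close>-descent set says that a truncated code entry has the maximal value.
\<close>

lemma inv_q_eq_collapse:
  assumes p: "p permutes {1..n + d}"
  shows "inv_q (Suc d) (n + d) p = (\<Sum>k=1..n. lehmer (collapse d n p) k)"
proof -
  have "(\<Sum>k=1..n. lehmer (collapse d n p) k) = (\<Sum>k=1..n. min (k - 1) (lehmer p (k + d)))"
    by (intro sum.cong) (auto simp: lehmer_collapse[OF p])
  also have "\<dots> = (\<Sum>i=1 + d..n + d. min (i - Suc d) (lehmer p i))"
    by (subst sum.shift_bounds_cl_nat_ivl) simp
  also have "\<dots> = (\<Sum>i=Suc d + 1..n + d. min (i - Suc d) (lehmer p i))"
    by (rule sum.mono_neutral_right) auto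
  finally show ?thesis by (simp add: inv_q_def lehmer_def)
qed

lemma card_smaller_before:
  assumes "inj p" "1 \<le> i"
  shows "card {j. 1 \<le> j \<and> j < i \<and> p j < p i} + lehmer p i = i - 1"
proof -
  have "card {j. 1 \<le> j \<and> j < i \<and> p j < p i} + lehmer p i
      = card ({j. 1 \<le> j \<and> j < i \<and> p j < p i} \<union> {j. 1 \<le> j \<and> j < i \<and> p j > p i})"
    unfolding lehmer_def by (intro card_Un_disjoint[symmetric]) auto
  also have "{j. 1 \<le> j \<and> j < i \<and> p j < p i} \<union> {j. 1 \<le> j \<and> j < i \<and> p j > p i} = {1..<i}"
    using assms(1) by (auto simp: inj_def) (metis less_irrefl linorder_neqE_nat)
  finally show ?thesis by simp
qed

text \<open>
  Descents are ascents of the code, so the claim compares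
  \<open>min (k - 1) (lehmer p (k + d))\<close> with \<open>min k (lehmer p (k + d + 1))\<close>: the second is larger iff
  the code of \<open>p\<close> ascends or its second entry is at least \<open>k\<close>.
\<close>

lemma Des_q_eq_collapse:
  assumes p: "p permutes {1..n + d}"
  shows "Des_q (Suc d) (n + d) p = (\<lambda>k. k + d) ` descents n (collapse d n p)"
proof -
  let ?w = "collapse d n p"
  have "k + d \<in> Des_q (Suc d) (n + d) p \<longleftrightarrow> k \<in> descents n ?w" if "1 \<le> k" "k < n" for k
  proof -
    have Del: "Suc (k + d) \<in> Del_q (Suc d) (n + d) p \<longleftrightarrow> k \<le> lehmer p (Suc (k + d))"
      using card_smaller_before[OF permutes_inj[OF p], of "Suc (k + d)"] that
      by (auto simp: Del_q_def)
    have "k + d \<in> Des_q (Suc d) (n + d) p \<longleftrightarrow>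
        lehmer p (k + d) < lehmer p (Suc (k + d)) \<or> k \<le> lehmer p (Suc (k + d))"
      using that descent_iff_lehmer[OF permutes_inj[OF p], of "k + d"] Del
      by (simp add: Des_q_def)
    also have "\<dots> \<longleftrightarrow> min (k - 1) (lehmer p (k + d)) < min k (lehmer p (Suc (k + d)))"
      using that by linarith
    also have "\<dots> \<longleftrightarrow> lehmer ?w k < lehmer ?w (Suc k)"
      using that by (simp add: lehmer_collapse[OF p])
    also have "\<dots> \<longleftrightarrow> k \<in> descents n ?w"
      using descent_iff_lehmer[OF permutes_inj[OF collapse_permutes[OF p]], of k] that
      by (simp add: descents_def)
    finally show ?thesis .
  qed
  note iff = this
  show ?thesis
  proof (rule set_eqI)
    fix i
    show "i \<in> Des_q (Suc d) (n + d) p \<longleftrightarrow> i \<in> (\<lambda>k. k + d) ` descents n ?w"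
    proof (cases "Suc d \<le> i \<and> i < n + d")
      case True
      then show ?thesis using iff[of "i - d"] by (auto simp: image_iff intro!: bexI[of _ "i - d"])
    next
      case False
      then show ?thesis by (auto simp: Des_q_def descents_def)
    qed
  qed
qed

lemma rmaj_q_eq_collapse:
  assumes "p permutes {1..n + d}"
  shows "rmaj_q (Suc d) (n + d) p = (\<Sum>k\<in>descents n (collapse d n p). n - k)"
  by (simp add: rmaj_q_def Des_q_eq_collapse[OF assms] sum.reindex inj_on_def)

lemma sum_collapse:
  fixes h :: "(nat \<Rightarrow> nat) \<Rightarrow> 'a::comm_semiring_1"
  shows "(\<Sum>p | p permutes {1..n + d}. h (collapse d n p))
       = (\<Sum>w | w permutes {1..n}. of_nat (fact d * Suc d ^ minima_count n w) * h w)"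
proof -
  have fin: "finite {p. p permutes {1..k}}" for k :: nat
    by (simp add: finite_permutations)
  have "(\<Sum>p | p permutes {1..n + d}. h (collapse d n p))
      = (\<Sum>w | w permutes {1..n}. \<Sum>p | p \<in> {p. p permutes {1..n + d}} \<and> collapse d n p = w.
          h (collapse d n p))"
    by (rule sum.group[symmetric]) (auto simp: fin collapse_permutes simp del: One_nat_def)
  also have "\<dots> = (\<Sum>w | w permutes {1..n}. of_nat (fact d * Suc d ^ minima_count n w) * h w)"
    by (rule sum.cong) (simp_all add: card_fiber_collapse[symmetric])
  finally show ?thesis .
qed

section \<open>Permutations as words\<close>

definition word_of :: "nat \<Rightarrow> (nat \<Rightarrow> nat) \<Rightarrow> nat list" where
  "word_of n w = map w [1..<Suc n]"

text \<open>
  The inverse of a permutation descends at \<open>i\<close> iff \<open>i + 1\<close> precedes \<open>i\<close> in its word.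
\<close>

definition inverse_descents :: "nat \<Rightarrow> nat list \<Rightarrow> nat set" where
  "inverse_descents n xs =
     {i. 1 \<le> i \<and> i < n \<and> filter (\<lambda>z. z = i \<or> z = Suc i) xs = [Suc i, i]}"

lemma word_of_Suc: "word_of (Suc n) w = word_of n w @ [w (Suc n)]"
  by (simp add: word_of_def)

lemma bij_betw_word_of:
  "bij_betw (word_of n) {w. w permutes {1..n}} (permutations_of_set {1..n})"
proof -
  have inj: "inj_on (word_of n) {w. w permutes {1..n}}"
  proof (rule inj_onI)
    fix u w assume uw: "u \<in> {w. w permutes {1..n}}" "w \<in> {w. w permutes {1..n}}"
      and eq: "word_of n u = word_of n w"
    show "u = w"
    proof
      fix k show "u k = w k"
      proof (cases "k \<in> {1..n}")
        case True
        then show ?thesis using eq by (auto simp: word_of_def)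
      next
        case False
        then show ?thesis using uw by (metis mem_Collect_eq permutes_not_in)
      qed
    qed
  qed
  have sub: "word_of n ` {w. w permutes {1..n}} \<subseteq> permutations_of_set {1..n}"
  proof
    fix xs assume "xs \<in> word_of n ` {w. w permutes {1..n}}"
    then obtain w where w: "w permutes {1..n}" and xs: "xs = word_of n w" by auto
    have iv: "{1..<Suc n} = {1..n}" by auto
    have "set xs = w ` {1..n}"
      unfolding xs word_of_def set_map set_upt iv ..
    moreover have "distinct xs"
      using permutes_inj_on[OF w] by (simp add: xs word_of_def distinct_map)
    ultimately show "xs \<in> permutations_of_set {1..n}"
      using permutes_image[OF w] by (intro permutations_of_setI) auto
  qed
  have "card (word_of n ` {w. w permutes {1..n}}) = card (permutations_of_set {1..n})"
    unfolding card_image[OF inj] by (simp add: card_permutations[OF refl])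
  then have "word_of n ` {w. w permutes {1..n}} = permutations_of_set {1..n}"
    using sub by (intro card_subset_eq) auto
  with inj show ?thesis by (simp add: bij_betw_def)
qed

lemma inversions_snoc:
  "inversions (v @ [x]) = inversions v + length (filter (\<lambda>z. x < z) v)"
  by (induction v) auto

lemma lehmer_Suc: "lehmer w (Suc n) = length (filter (\<lambda>z. w (Suc n) < z) (word_of n w))"
proof -
  have "length (filter (\<lambda>z. w (Suc n) < z) (word_of n w))
      = length (filter (\<lambda>j. w (Suc n) < w j) [1..<Suc n])"
    by (simp add: word_of_def filter_map comp_def del: upt_Suc)
  also have "\<dots> = card (set (filter (\<lambda>j. w (Suc n) < w j) [1..<Suc n]))"
    by (intro distinct_card[symmetric]) simp
  also have "set (filter (\<lambda>j. w (Suc n) < w j) [1..<Suc n])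
      = {j. 1 \<le> j \<and> j < Suc n \<and> w (Suc n) < w j}"
    by auto
  finally show ?thesis by (simp add: lehmer_def)
qed

lemma inversions_word_of: "inversions (word_of n w) = (\<Sum>k=1..n. lehmer w k)"
proof (induction n)
  case 0
  then show ?case by (simp add: word_of_def)
next
  case (Suc n)
  then show ?case by (simp add: word_of_Suc inversions_snoc lehmer_Suc)
qed

lemma lr_minima_snoc:
  "lr_minima (v @ [x]) = (if \<forall>y\<in>set v. x < y then lr_minima v @ [x] else lr_minima v)"
  by (induction v) auto

lemma length_lr_minima_word_of: "length (lr_minima (word_of n w)) = minima_count n w"
proof (induction n)
  case 0
  then show ?case by (simp add: word_of_def minima_count_def)
next
  case (Suc n)
  have "lehmer w (Suc n) = n \<longleftrightarrow> (\<forall>y\<in>set (word_of n w). w (Suc n) < y)"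
  proof -
    have "length (word_of n w) = n" by (simp add: word_of_def)
    then show ?thesis
      unfolding lehmer_Suc by (metis filter_id_conv length_filter_less nat_less_le)
  qed
  moreover have "{k \<in> {1..Suc n}. lehmer w k = k - 1}
      = (if lehmer w (Suc n) = n then insert (Suc n) else id) {k \<in> {1..n}. lehmer w k = k - 1}"
    by (auto simp: le_Suc_eq)
  ultimately show ?case
    using Suc by (auto simp: word_of_Suc lr_minima_snoc minima_count_def)
qed

lemma rev_major_word_of: "rev_major (word_of n w) = (\<Sum>k\<in>descents n w. n - k)"
proof -
  have "rev_major (map w [a..<Suc n]) = (\<Sum>k | a \<le> k \<and> k < n \<and> w (Suc k) < w k. n - k)"
    if "a \<le> n" for a
    using that
  proof (induction rule: inc_induct)
    case base
    have "{k. n \<le> k \<and> k < n \<and> w (Suc k) < w k} = {}" by auto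
    then show ?case by simp
  next
    case (step a)
    have set: "{k. a \<le> k \<and> k < n \<and> w (Suc k) < w k}
        = (if w (Suc a) < w a then insert a else id) {k. Suc a \<le> k \<and> k < n \<and> w (Suc k) < w k}"
      using step.hyps by (auto simp: Suc_le_eq le_less)
    have fin: "finite {k. Suc a \<le> k \<and> k < n \<and> w (Suc k) < w k}"
      by (rule finite_subset[of _ "{..n}"]) auto
    have "[a..<Suc n] = a # Suc a # [Suc (Suc a)..<Suc n]"
      and "[Suc a..<Suc n] = Suc a # [Suc (Suc a)..<Suc n]"
      using step.hyps by (auto simp: upt_conv_Cons simp del: upt_Suc)
    then have "rev_major (map w [a..<Suc n])
        = (if w (Suc a) < w a then n - a else 0) + rev_major (map w [Suc a..<Suc n])"
      using step.hyps by (simp add: Suc_diff_Suc del: upt_Suc)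
    with step.IH fin show ?case unfolding set by simp
  qed
  then show ?thesis
    by (cases "n = 0") (simp_all add: word_of_def descents_def del: upt_Suc)
qed

lemma inverse_descents_word_of:
  assumes w: "w permutes {1..n}"
  shows "inverse_descents n (word_of n w) = descents n (inv w)"
proof -
  have "filter (\<lambda>z. z = i \<or> z = Suc i) (word_of n w) = [Suc i, i] \<longleftrightarrow> inv w (Suc i) < inv w i"
    if i: "1 \<le> i" "i < n" for i
  proof -
    define a b where "a = inv w i" and "b = inv w (Suc i)"
    have wab: "w a = i" "w b = Suc i"
      by (simp_all add: a_def b_def permutes_inverses[OF w])
    then have "a \<noteq> b" by auto
    have range: "a \<in> {1..n}" "b \<in> {1..n}"
      using permutes_in_seg[OF permutes_inv[OF w], of i]
        permutes_in_seg[OF permutes_inv[OF w], of "Suc i"] i by (auto simp: a_def b_def)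
    have iff: "w k = i \<or> w k = Suc i \<longleftrightarrow> k = a \<or> k = b" for k
      using wab permutes_inverses[OF w] by (metis a_def b_def)
    \<comment> \<open>The letters \<open>i\<close> and \<open>i + 1\<close> are listed by increasing position, that is, \<open>a\<close> and \<open>b\<close> are sorted.\<close>
    let ?ks = "filter (\<lambda>k. k = a \<or> k = b) [1..<Suc n]"
    have "set ?ks = {a, b}" using range by auto
    moreover have "sorted ?ks" "distinct ?ks"
      by (simp_all add: sorted_wrt_filter del: upt_Suc)
    ultimately have "?ks = sorted_list_of_set {a, b}"
      by (metis sorted_list_of_set.idem_if_sorted_distinct)
    also have "\<dots> = (if a < b then [a, b] else [b, a])"
      using \<open>a \<noteq> b\<close> by simp
    finally have ks: "?ks = (if a < b then [a, b] else [b, a])" .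
    have "filter (\<lambda>z. z = i \<or> z = Suc i) (word_of n w) = map w ?ks"
      by (simp add: word_of_def filter_map comp_def iff del: upt_Suc)
    also have "\<dots> = (if a < b then [i, Suc i] else [Suc i, i])"
      unfolding ks by (simp add: wab)
    finally show ?thesis using \<open>a \<noteq> b\<close> by (auto simp: a_def b_def)
  qed
  then show ?thesis by (auto simp: inverse_descents_def descents_def)
qed

text \<open>
  The transformation turns \<open>rev_major\<close> into \<open>inversions\<close> while keeping the inverse descents and
  the left-to-right minima, so it reindexes one sum to the other.
\<close>

lemma sum_inversions_eq_sum_rev_major:
  fixes F G H :: "_ \<Rightarrow> 'a::comm_semiring_1"
  shows "(\<Sum>w | w permutes {1..n}.
           H (minima_count n w) * (F (\<Sum>k=1..n. lehmer w k) * G (descents n (inv w))))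
       = (\<Sum>w | w permutes {1..n}.
           H (minima_count n w) * (F (\<Sum>k\<in>descents n w. n - k) * G (descents n (inv w))))"
proof -
  let ?W = "permutations_of_set {1..n}"
  let ?h = "\<lambda>stat xs. H (length (lr_minima xs)) * (F (stat xs) * G (inverse_descents n xs))"
  have "(\<Sum>w | w permutes {1..n}. ?h inversions (word_of n w)) = (\<Sum>xs\<in>?W. ?h inversions xs)"
    by (rule sum.reindex_bij_betw[OF bij_betw_word_of])
  also have "\<dots> = (\<Sum>xs\<in>?W. ?h inversions (foata xs))"
    by (rule sum.reindex_bij_betw[symmetric, OF bij_betw_foata]) simp
  also have "\<dots> = (\<Sum>xs\<in>?W. ?h rev_major xs)"
    by (rule sum.cong)
      (auto dest!: permutations_of_setD(2)
        simp: inversions_foata lr_minima_foata filter_adjacent_foata inverse_descents_def)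
  also have "\<dots> = (\<Sum>w | w permutes {1..n}. ?h rev_major (word_of n w))"
    by (rule sum.reindex_bij_betw[symmetric, OF bij_betw_word_of])
  finally show ?thesis
    by (simp add: inversions_word_of rev_major_word_of length_lr_minima_word_of
        inverse_descents_word_of)
qed

text \<open>
  Both identities of the theorem come from this one, since \<open>des_q\<close> and \<open>rmaj_q\<close> of the inverse are
  functions of its \<open>q\<close>-descent set.
\<close>

lemma sum_inv_q_eq_sum_rmaj_q:
  fixes F :: "nat \<Rightarrow> 'a::comm_semiring_1" and G :: "nat set \<Rightarrow> 'a"
  shows "(\<Sum>p | p permutes {1..n + d}.
           F (inv_q (Suc d) (n + d) p) * G (Des_q (Suc d) (n + d) (inv p)))
       = (\<Sum>p | p permutes {1..n + d}.
           F (rmaj_q (Suc d) (n + d) p) * G (Des_q (Suc d) (n + d) (inv p)))"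
proof -
  let ?G = "\<lambda>D. G ((\<lambda>k. k + d) ` D)"
  have Des: "Des_q (Suc d) (n + d) (inv p) = (\<lambda>k. k + d) ` descents n (inv (collapse d n p))"
    if "p permutes {1..n + d}" for p
    using that by (simp add: Des_q_eq_collapse permutes_inv collapse_inv)
  have "(\<Sum>p | p permutes {1..n + d}.
           F (inv_q (Suc d) (n + d) p) * G (Des_q (Suc d) (n + d) (inv p)))
      = (\<Sum>p | p permutes {1..n + d}. F (\<Sum>k=1..n. lehmer (collapse d n p) k)
           * ?G (descents n (inv (collapse d n p))))"
    by (intro sum.cong) (simp_all add: inv_q_eq_collapse Des)
  also have "\<dots> = (\<Sum>w | w permutes {1..n}. of_nat (fact d * Suc d ^ minima_count n w)
           * (F (\<Sum>k=1..n. lehmer w k) * ?G (descents n (inv w))))"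
    by (rule sum_collapse)
  also have "\<dots> = (\<Sum>w | w permutes {1..n}. of_nat (fact d * Suc d ^ minima_count n w)
           * (F (\<Sum>k\<in>descents n w. n - k) * ?G (descents n (inv w))))"
    by (rule sum_inversions_eq_sum_rev_major)
  also have "\<dots> = (\<Sum>p | p permutes {1..n + d}. F (\<Sum>k\<in>descents n (collapse d n p). n - k)
           * ?G (descents n (inv (collapse d n p))))"
    by (rule sum_collapse[symmetric])
  also have "\<dots> = (\<Sum>p | p permutes {1..n + d}.
           F (rmaj_q (Suc d) (n + d) p) * G (Des_q (Suc d) (n + d) (inv p)))"
    by (intro sum.cong) (simp_all add: rmaj_q_eq_collapse Des)
  finally show ?thesis .
qed

theorem corollary11p6:
  fixes n q m :: nat
  assumes "n \<ge> 1" and "q \<ge> 1" and "m = n + q - 1"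
  shows "(\<Sum>\<pi> | \<pi> permutes {1..m}. t1 ^ inv_q q m \<pi> * t2 ^ des_q q m (inv \<pi>)) =
         (\<Sum>\<pi> | \<pi> permutes {1..m}. t1 ^ rmaj_q q m \<pi> * t2 ^ des_q q m (inv \<pi>))
       \<and> (\<Sum>\<pi> | \<pi> permutes {1..m}. t1 ^ inv_q q m \<pi> * t2 ^ rmaj_q q m (inv \<pi>)) =
         (\<Sum>\<pi> | \<pi> permutes {1..m}. t1 ^ rmaj_q q m \<pi> * t2 ^ rmaj_q q m (inv \<pi>))"
proof -
  obtain d where q: "q = Suc d" using assms(2) by (cases q) auto
  then have m: "m = n + d" using assms(3) by simp
  show ?thesis
    unfolding q m des_q_def rmaj_q_def[of _ _ "inv _"]
    by (intro conjI
        sum_inv_q_eq_sum_rmaj_q[where F = "\<lambda>i. t1 ^ i" and G = "\<lambda>D. t2 ^ card D"]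
        sum_inv_q_eq_sum_rmaj_q[where F = "\<lambda>i. t1 ^ i" and G = "\<lambda>D. t2 ^ (\<Sum>i\<in>D. n + d - i)"])
qed

end
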